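(* Let the integers $p^A(n)$, $n \ge 0$, be defined by $$\sum_{n=0}^\infty p^A(n) q^n = \frac{1}{2} \prod_{j=1}^\infty \frac{1}{(1-q^j)^2} + \frac{1}{2} \prod_{j=1}^\infty \frac{1}{1-q^{2j}}.$$ Then for all $n \ge 0$: $$p^A(5n+3) \equiv 0 \pmod 5,$$ $$p^A(10n+7) \equiv 0 \pmod 5,$$ $$p^A(10n+9) \equiv 0 \pmod 5,$$ $$p^A(25n+23) \equiv 0 \pmod{25}.$$
   Context: The products are formal power series in $q$ with integer coefficients; the displayed half-sum has integer coefficients (it is the conjugacy growth series of the finitary alternating group of an infinite set with respect to the generating set of all $3$-cycles). *)

theory Defs
  imports "HOL-Analysis.Infinite_Products" "HOL-Computational_Algebra.Formal_Power_Series"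
    "HOL-Number_Theory.Cong"
begin

text \<open>
  The library operator \<^const>\<open>prodinf\<close> runs over indices \<open>0, 1, 2, \<dots>\<close>, so the \<open>j\<close>-th factor of a
  product over \<open>j \<ge> 1\<close> occurs at index \<open>j - 1\<close>; limits are taken in the topology of formal power
  series. Since \<^const>\<open>prodinf\<close> is underspecified for divergent products, this theory shows
  that the two products used below converge, and that their half-sum has integer coefficients.
\<close>

lemma fps_has_prod_truncated:
  fixes f :: "nat \<Rightarrow> 'a :: idom fps"
  assumes f0: "\<And>k. fps_nth (f k) 0 = 1"
    and f: "\<And>k i. 0 < i \<Longrightarrow> i \<le> k \<Longrightarrow> fps_nth (f k) i = 0"
  shows "f has_prod Abs_fps (\<lambda>n. fps_nth (\<Prod>k\<le>n. f k) n)"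
proof -
  let ?P = "Abs_fps (\<lambda>n. fps_nth (\<Prod>k\<le>n. f k) n)"
  have stable: "fps_nth (\<Prod>k\<le>N. f k) n = fps_nth (\<Prod>k\<le>n. f k) n" if "N \<ge> n" for N n
    using that
  proof (induction N rule: dec_induct)
    case (step N)
    have "fps_nth (\<Prod>k\<le>Suc N. f k) n
        = (\<Sum>i=0..n. fps_nth (\<Prod>k\<le>N. f k) i * fps_nth (f (Suc N)) (n - i))"
      by (simp add: fps_mult_nth)
    also have "\<dots> = (\<Sum>i=0..n. if i = n then fps_nth (\<Prod>k\<le>N. f k) n else 0)"
      using step.hyps by (intro sum.cong) (auto simp: f0 f)
    finally show ?case
      using step.IH by simp
  qed simp
  have "(\<lambda>N. \<Prod>k\<le>N. f k) \<longlonglongrightarrow> ?P"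
  proof (rule tendsto_fpsI)
    fix n
    show "\<forall>\<^sub>F N in sequentially. fps_nth (\<Prod>k\<le>N. f k) n = fps_nth ?P n"
      using eventually_ge_at_top[of n] by eventually_elim (subst fps_nth_Abs_fps, rule stable)
  qed
  moreover have "fps_nth ?P 0 = 1"
    by (simp add: f0)
  hence "?P \<noteq> 0"
    by (metis fps_zero_nth zero_neq_one)
  ultimately show ?thesis
    by (simp add: has_prod_def raw_has_prod_def)
qed

definition geometric_fps :: "nat \<Rightarrow> 'a :: comm_ring_1 fps" where
  "geometric_fps m = Abs_fps (\<lambda>n. if m dvd n then 1 else 0)"

lemma geometric_fps_mult:
  assumes "m > 0"
  shows "geometric_fps m * (1 - fps_X ^ m) = (1 :: 'a :: comm_ring_1 fps)"
proof (rule fps_ext)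
  fix n
  show "fps_nth (geometric_fps m * (1 - fps_X ^ m)) n = fps_nth (1 :: 'a fps) n"
    using assms
    by (auto simp: right_diff_distrib fps_X_power_mult_right_nth geometric_fps_def dvd_minus_self
          dest: dvd_imp_le)
qed

lemma fps_divide_one_minus_X_power:
  assumes "m > 0"
  shows "1 / (1 - fps_X ^ m) = (geometric_fps m :: 'a :: field fps)"
proof -
  have "1 - fps_X ^ m \<noteq> (0 :: 'a fps)"
    using geometric_fps_mult[OF assms, where 'a = 'a] by auto
  thus ?thesis
    using geometric_fps_mult[OF assms, where 'a = 'a]
    by (metis nonzero_mult_div_cancel_right)
qed

lemma fps_divide_one_minus_X_power_sq:
  assumes "m > 0"
  shows "1 / (1 - fps_X ^ m)\<^sup>2 = ((geometric_fps m)\<^sup>2 :: 'a :: field fps)"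
proof -
  have *: "(geometric_fps m)\<^sup>2 * (1 - fps_X ^ m)\<^sup>2 = (1 :: 'a fps)"
    by (simp add: geometric_fps_mult[OF assms] flip: power_mult_distrib)
  hence "(1 - fps_X ^ m)\<^sup>2 \<noteq> (0 :: 'a fps)"
    by force
  thus ?thesis
    using * by (metis nonzero_mult_div_cancel_right)
qed

lemma has_prod_A:
  "(\<lambda>j. 1 / (1 - fps_X ^ Suc j)\<^sup>2 :: 'a :: field fps)
     has_prod Abs_fps (\<lambda>n. fps_nth (\<Prod>j\<le>n. (geometric_fps (Suc j))\<^sup>2) n)"
proof -
  have "fps_nth ((geometric_fps (Suc k))\<^sup>2 :: 'a fps) i = 0" if "0 < i" "i \<le> k" for i k
    using that by (auto simp: power2_eq_square fps_mult_nth geometric_fps_def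
        intro!: sum.neutral dest!: dvd_imp_le)
  thus ?thesis
    unfolding fps_divide_one_minus_X_power_sq[OF zero_less_Suc]
    by (intro fps_has_prod_truncated) (auto simp: geometric_fps_def power2_eq_square)
qed

lemma has_prod_B:
  "(\<lambda>j. 1 / (1 - fps_X ^ (2 * Suc j)) :: 'a :: field fps)
     has_prod Abs_fps (\<lambda>n. fps_nth (\<Prod>j\<le>n. geometric_fps (2 * Suc j)) n)"
proof -
  have "(\<lambda>j. 1 / (1 - fps_X ^ (2 * Suc j)) :: 'a fps) = (\<lambda>j. geometric_fps (2 * Suc j))"
    by (intro ext fps_divide_one_minus_X_power) simp
  moreover have "(\<lambda>j. geometric_fps (2 * Suc j) :: 'a fps)
     has_prod Abs_fps (\<lambda>n. fps_nth (\<Prod>j\<le>n. geometric_fps (2 * Suc j)) n)"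
    by (intro fps_has_prod_truncated) (auto simp: geometric_fps_def dest!: dvd_imp_le)
  ultimately show ?thesis
    by simp
qed

lemma geometric_fps_parity:
  assumes "m > 0"
  shows "(2 :: int fps) dvd (geometric_fps m)\<^sup>2 - geometric_fps (2 * m)"
proof -
  let ?G = "geometric_fps m :: int fps" and ?H = "geometric_fps (2 * m) :: int fps"
  let ?x = "fps_X ^ m :: int fps"
  have G: "?G * (1 - ?x) = 1" and H: "?H * (1 - ?x\<^sup>2) = 1"
    using geometric_fps_mult[of m, where 'a = int] geometric_fps_mult[of "2 * m", where 'a = int] assms
    by (simp_all add: power_mult mult.commute[of 2])
  have "?G\<^sup>2 - ?H = ?G\<^sup>2 * (?H * (1 - ?x\<^sup>2)) - ?H * (?G * (1 - ?x))\<^sup>2"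
    unfolding G H by simp
  also have "\<dots> = 2 * (?G\<^sup>2 * ?H * (?x - ?x\<^sup>2))"
    by (simp add: algebra_simps power2_eq_square)
  finally show ?thesis
    by simp
qed

lemma prod_parity:
  "(2 :: int fps) dvd (\<Prod>j\<le>n. (geometric_fps (Suc j))\<^sup>2) - (\<Prod>j\<le>n. geometric_fps (2 * Suc j))"
proof (induction n)
  case 0
  show ?case
    using geometric_fps_parity[of 1] by simp
next
  case (Suc n)
  have *: "(a :: int fps) * b - c * d = (a - c) * b + c * (b - d)" for a b c d
    by (simp add: algebra_simps)
  show ?case
    unfolding prod.atMost_Suc * using Suc geometric_fps_parity[of "Suc (Suc n)"]
    by (intro dvd_add dvd_mult2 dvd_mult) simp_all
qed

lemma of_int_fps_nth_mult:
  assumes "\<And>n. of_int (fps_nth F n) = fps_nth F' n" "\<And>n. of_int (fps_nth G n) = fps_nth G' n"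
  shows "of_int (fps_nth (F * G) n) = fps_nth (F' * G' :: 'a :: comm_ring_1 fps) n"
  by (simp add: fps_mult_nth assms)

lemma of_int_fps_nth_prod:
  assumes "\<And>j n. of_int (fps_nth (F j) n) = fps_nth (G j) n"
  shows "of_int (fps_nth (\<Prod>j\<in>A. F j) n) = fps_nth (\<Prod>j\<in>A. G j :: 'a :: comm_ring_1 fps) n"
proof (induction A arbitrary: n rule: infinite_finite_induct)
  case (insert a A)
  thus ?case
    by (simp add: of_int_fps_nth_mult assms)
qed simp_all

lemma of_int_geometric_fps:
  "of_int (fps_nth (geometric_fps m) n) = fps_nth (geometric_fps m :: 'a :: comm_ring_1 fps) n"
  by (simp add: geometric_fps_def)

lemma of_int_geometric_fps_sq:
  "of_int (fps_nth ((geometric_fps m)\<^sup>2) n)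
     = fps_nth ((geometric_fps m)\<^sup>2 :: 'a :: comm_ring_1 fps) n"
  unfolding power2_eq_square by (intro of_int_fps_nth_mult of_int_geometric_fps)

theorem half_sum_integral:
  "\<exists>pA :: nat \<Rightarrow> int. Abs_fps (\<lambda>n. of_int (pA n) :: rat) =
     fps_const (1 / 2) * (\<Prod>j. 1 / (1 - fps_X ^ Suc j)\<^sup>2) +
     fps_const (1 / 2) * (\<Prod>j. 1 / (1 - fps_X ^ (2 * Suc j)))"
proof -
  define a :: "nat \<Rightarrow> int" where "a n = fps_nth (\<Prod>j\<le>n. (geometric_fps (Suc j))\<^sup>2) n" for n
  define b :: "nat \<Rightarrow> int" where "b n = fps_nth (\<Prod>j\<le>n. geometric_fps (2 * Suc j)) n" for n
  have "even (a n - b n)" for n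
  proof -
    obtain F where "(\<Prod>j\<le>n. (geometric_fps (Suc j))\<^sup>2)
        - (\<Prod>j\<le>n. geometric_fps (2 * Suc j)) = (2 :: int fps) * F"
      using prod_parity[of n] by (elim dvdE)
    hence "a n - b n = fps_nth (2 * F) n"
      unfolding a_def b_def by (metis fps_sub_nth)
    thus ?thesis
      by (simp add: numeral_fps_const)
  qed
  hence "even (a n + b n)" for n
    by simp
  hence half: "of_int ((a n + b n) div 2) = (of_int (a n) + of_int (b n)) / (2 :: rat)" for n
    by (metis dvd_mult_div_cancel nonzero_mult_div_cancel_left of_int_add of_int_mult
        of_int_numeral zero_neq_numeral)
  have A: "(\<Prod>j. 1 / (1 - fps_X ^ Suc j)\<^sup>2) = Abs_fps (\<lambda>n. of_int (a n) :: rat)"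
    using has_prod_unique[OF has_prod_A[where 'a = rat]]
    by (simp add: a_def of_int_fps_nth_prod[OF of_int_geometric_fps_sq])
  have B: "(\<Prod>j. 1 / (1 - fps_X ^ (2 * Suc j))) = Abs_fps (\<lambda>n. of_int (b n) :: rat)"
    using has_prod_unique[OF has_prod_B[where 'a = rat]]
    by (simp add: b_def of_int_fps_nth_prod[OF of_int_geometric_fps])
  show ?thesis
    unfolding A B by (rule exI[of _ "\<lambda>n. (a n + b n) div 2"]) (simp add: fps_eq_iff half field_simps)
qed

end

theory Submission
  imports Defs "HOL-Library.Nat_Bijection" "HOL-Computational_Algebra.Polynomial"
begin

text \<open>
  Write \<open>E\<close> for the Euler product and \<open>P = 1 / E\<close>, so that \<open>2 p\<^sup>A(n)\<close> is the \<open>n\<close>-th coefficient of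
  \<open>P(q)\<^sup>2 + P(q\<^sup>2)\<close>. By the pentagonal number theorem \<open>E = a + b + c\<close>, where \<open>a, b, c\<close> collect
  the exponents congruent to 0, 1, 2 modulo 5, and \<open>b / q\<close> is a series in \<open>q\<^sup>2\<^sup>5\<close>. Jacobi's identity for
  \<open>E\<^sup>3\<close> shows that this cube has no exponent congruent to 2 modulo 5, which means \<open>a c = - b\<^sup>2\<close>.
  Multiplying numerator and denominator of \<open>P\<close> by the conjugates of \<open>E\<close> under \<open>q \<mapsto> \<zeta> q\<close>, where
  \<open>\<zeta>\<^sup>5 = 1\<close>, gives the denominator \<open>N = a\<^sup>5 + 11 b\<^sup>5 + c\<^sup>5\<close>, a series in \<open>q\<^sup>5\<close>. The part of \<open>P\<close> with
  exponents 4 modulo 5 is then \<open>5 b\<^sup>4 / N\<close>, and the part of \<open>P\<^sup>2\<close> with exponents 3 modulo 5 is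
  \<open>- 10 b\<^sup>3 / N + 125 b\<^sup>8 / N\<^sup>2\<close>. Since \<open>1 / N \<equiv> P\<^sup>5 \<equiv> P(q\<^sup>5)\<close> modulo 5, the congruence
  \<open>p(5 n + 4) \<equiv> 0\<close> modulo 5 for the coefficients of \<open>P\<close> yields the congruences modulo 25. Modulo 5,
  \<open>P\<^sup>2 = E\<^sup>3 P\<^sup>5 \<equiv> E\<^sup>3 P(q\<^sup>5)\<close>, and the coefficients of \<open>E\<^sup>3\<close> at exponents 2, 3, 4 modulo 5
  are divisible by 5.
\<close>

subsection \<open>Congruences and finite products\<close>

lemma fps_X_power_dvd_iff:
  "fps_X ^ n dvd (f :: 'a :: comm_ring_1 fps) \<longleftrightarrow> (\<forall>i<n. fps_nth f i = 0)"
proof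
  assume "fps_X ^ n dvd f"
  thus "\<forall>i<n. fps_nth f i = 0"
    by (auto simp: fps_X_power_mult_nth elim!: dvdE)
next
  assume *: "\<forall>i<n. fps_nth f i = 0"
  have "f = fps_X ^ n * fps_shift n f"
    using * by (auto simp: fps_eq_iff fps_X_power_mult_nth)
  thus "fps_X ^ n dvd f"
    by (rule dvdI)
qed

lemma dvd_numeral_fps_iff:
  "numeral k dvd (f :: 'a :: comm_ring_1 fps) \<longleftrightarrow> (\<forall>n. numeral k dvd fps_nth f n)"
proof
  assume "numeral k dvd f"
  thus "\<forall>n. numeral k dvd fps_nth f n"
    by (auto simp: numeral_fps_const elim!: dvdE)
next
  assume "\<forall>n. numeral k dvd fps_nth f n"
  then obtain g where "\<And>n. fps_nth f n = numeral k * g n"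
    unfolding dvd_def by metis
  hence "f = numeral k * Abs_fps g"
    by (simp add: fps_eq_iff numeral_fps_const)
  thus "numeral k dvd f"
    by (rule dvdI)
qed

text \<open>The half-open range makes this the quotient (q;q)_n / (q;q)_m for
  \<open>m \<le> n\<close>, so that adjacent ranges multiply as in
  \<open>qprod_trans\<close>.\<close>

definition qprod :: "nat \<Rightarrow> nat \<Rightarrow> int fps" where
  "qprod m n = (\<Prod>i\<in>{m<..n}. 1 - fps_X ^ i)"

lemma qprod_refl [simp]: "qprod n n = 1"
  by (simp add: qprod_def)

lemma qprod_Suc_right: "m \<le> n \<Longrightarrow> qprod m (Suc n) = qprod m n * (1 - fps_X ^ Suc n)"
proof -
  assume "m \<le> n"
  hence "{m<..Suc n} = insert (Suc n) {m<..n}" by auto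
  thus ?thesis by (simp add: qprod_def)
qed

lemma qprod_Suc_left: "m < n \<Longrightarrow> qprod m n = (1 - fps_X ^ Suc m) * qprod (Suc m) n"
proof -
  assume "m < n"
  hence "{m<..n} = insert (Suc m) {Suc m<..n}" by auto
  thus ?thesis by (simp add: qprod_def)
qed

lemma qprod_nth_0 [simp]: "fps_nth (qprod m n) 0 = 1"
proof (induction n)
  case (Suc n)
  thus ?case
    by (cases "m \<le> n") (simp_all add: qprod_Suc_right, simp add: qprod_def)
qed (simp add: qprod_def)

lemma qprod_trans: "l \<le> m \<Longrightarrow> m \<le> n \<Longrightarrow> qprod l m * qprod m n = qprod l n"
proof (induction n)
  case (Suc n)
  thus ?case
    by (cases "m = Suc n") (simp_all add: qprod_Suc_right flip: mult.assoc)
qed simp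

text \<open>Two kinds of modulus occur: a power of \<open>fps_X\<close>, which compares initial
  coefficients, and 5, which compares all coefficients modulo 5.\<close>

definition eqmod :: "'a :: comm_ring_1 \<Rightarrow> 'a \<Rightarrow> 'a \<Rightarrow> bool" where
  "eqmod d a b \<longleftrightarrow> d dvd a - b"

lemma eqmod_refl [simp]: "eqmod d a a"
  by (simp add: eqmod_def)

lemma eqmod_sym: "eqmod d a b \<Longrightarrow> eqmod d b a"
  by (metis eqmod_def dvd_minus_iff minus_diff_eq)

lemma eqmod_trans [trans]: "eqmod d a b \<Longrightarrow> eqmod d b c \<Longrightarrow> eqmod d a c"
  unfolding eqmod_def by (metis diff_add_cancel dvd_add_right_iff add_diff_eq)

lemma eqmod_weaken: "eqmod d a b \<Longrightarrow> d' dvd d \<Longrightarrow> eqmod d' a b"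
  unfolding eqmod_def by (rule dvd_trans)

lemma eqmod_add: "eqmod d a b \<Longrightarrow> eqmod d a' b' \<Longrightarrow> eqmod d (a + a') (b + b')"
  unfolding eqmod_def by (metis add_diff_add dvd_add)

lemma eqmod_diff: "eqmod d a b \<Longrightarrow> eqmod d a' b' \<Longrightarrow> eqmod d (a - a') (b - b')"
proof -
  assume "eqmod d a b" "eqmod d a' b'"
  moreover have "a - a' - (b - b') = (a - b) - (a' - b')"
    by simp
  ultimately show ?thesis
    unfolding eqmod_def by (metis dvd_diff)
qed

lemma eqmod_mult: "eqmod d a b \<Longrightarrow> eqmod d a' b' \<Longrightarrow> eqmod d (a * a') (b * b')"
proof -
  assume "eqmod d a b" "eqmod d a' b'"
  moreover have "a * a' - b * b' = (a - b) * a' + b * (a' - b')"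
    by (simp add: algebra_simps)
  ultimately show ?thesis
    unfolding eqmod_def by (metis dvd_add dvd_mult dvd_mult2)
qed

lemma eqmod_scale: "eqmod d a b \<Longrightarrow> eqmod (c * d) (c * a) (c * b)"
  unfolding eqmod_def by (metis mult_dvd_mono dvd_refl right_diff_distrib)

lemma eqmod_power: "eqmod d a b \<Longrightarrow> eqmod d (a ^ n) (b ^ n)"
  by (induction n) (auto intro: eqmod_mult)

lemma eqmod_sum: "(\<And>x. x \<in> A \<Longrightarrow> eqmod d (f x) (g x)) \<Longrightarrow> eqmod d (sum f A) (sum g A)"
  by (simp add: eqmod_def dvd_sum flip: sum_subtractf)

lemma qprod_eq_1_mod: "fps_X ^ Suc m dvd qprod m n - 1"
proof (induction n)
  case (Suc n)
  show ?case
  proof (cases "m \<le> n")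
    case True
    have "qprod m (Suc n) - 1 = (qprod m n - 1) - qprod m n * fps_X ^ Suc n"
      using True by (simp add: qprod_Suc_right algebra_simps)
    thus ?thesis
      using Suc True by (metis Suc_le_mono dvd_diff dvd_mult le_imp_power_dvd)
  qed (simp add: qprod_def)
qed (simp add: qprod_def)

text \<open>Factors of index above n do not affect the coefficient of q^n, so this diagonal is the
  infinite product, formed without a limit.\<close>

definition euler_fps :: "int fps" where
  "euler_fps = Abs_fps (\<lambda>n. fps_nth (qprod 0 n) n)"

lemma qprod_eq_euler_mod: "fps_X ^ Suc n dvd qprod 0 n - euler_fps"
  unfolding fps_X_power_dvd_iff
proof safe
  fix i assume "i < Suc n"
  have "fps_X ^ Suc i dvd qprod 0 i * (qprod i n - 1)"
    using qprod_eq_1_mod by (rule dvd_mult)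
  also have "\<dots> = qprod 0 n - qprod 0 i"
    using \<open>i < Suc n\<close> by (simp add: right_diff_distrib qprod_trans)
  finally show "fps_nth (qprod 0 n - euler_fps) i = 0"
    unfolding fps_X_power_dvd_iff by (auto simp: euler_fps_def)
qed

lemma euler_fps_nth_0 [simp]: "fps_nth euler_fps 0 = 1"
  by (simp add: euler_fps_def)

subsection \<open>The pentagonal number theorem\<close>

text \<open>Shanks's identity: a sum that telescopes in \<open>n\<close> to the pentagonal series, and whose
  terms with \<open>s > 0\<close> vanish to order greater than \<open>n\<close>.\<close>

definition shanks_term :: "nat \<Rightarrow> nat \<Rightarrow> int fps" where
  "shanks_term n s = (-1) ^ s * qprod s n * fps_X ^ (n * s + triangle s)"

lemma shanks_term_diff_sum:
  "k \<le> n \<Longrightarrow> (\<Sum>s\<le>k. shanks_term (Suc n) s - shanks_term n s)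
     = - ((-1) ^ k * qprod k n * fps_X ^ (Suc n * Suc k + triangle k))"
proof (induction k)
  case 0
  show ?case by (simp add: shanks_term_def qprod_Suc_right algebra_simps)
next
  case (Suc k)
  have *: "qprod k n = (1 - fps_X ^ Suc k) * qprod (Suc k) n"
    using Suc.prems by (intro qprod_Suc_left) simp
  show ?case
    using Suc by (simp add: shanks_term_def qprod_Suc_right * algebra_simps power_add)
qed

text \<open>With m = \<open>Suc n\<close>, the power with \<open>triangle (Suc n)\<close> is the new
  top term and the other is the telescoped remainder at \<open>k = n\<close>. Their exponents are
  m(3m+1)/2 and m(3m-1)/2.\<close>

lemma shanks_sum_Suc:
  "(\<Sum>s\<le>Suc n. shanks_term (Suc n) s) = (\<Sum>s\<le>n. shanks_term n s)
     + (-1) ^ Suc n * (fps_X ^ (Suc n * Suc n + triangle (Suc n)) + fps_X ^ (Suc n * Suc n + triangle n))"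
  using shanks_term_diff_sum[of n n]
  by (simp add: sum_subtractf shanks_term_def algebra_simps)

lemma two_triangle: "2 * triangle n = n * Suc n"
  by (induction n) auto

text \<open>Letting \<open>s\<close> run over positive and negative integers covers both pentagonal
  exponents by one formula; the induction step adds s = m and s = -m.\<close>

lemma shanks_sum_nth:
  "fps_nth (\<Sum>s\<le>n. shanks_term n s) k
     = (\<Sum>s | \<bar>s\<bar> \<le> int n \<and> s * (3 * s + 1) = 2 * int k. (-1) ^ nat \<bar>s\<bar>)"
proof (induction n)
  case 0
  have "{s. \<bar>s\<bar> \<le> int 0 \<and> s * (3 * s + 1) = 2 * int k} = (if k = 0 then {0} else {})"
    by auto
  thus ?case by (simp add: shanks_term_def)
next
  case (Suc n)
  define m where "m = Suc n"
  have *: "x = 2 * int a \<Longrightarrow> x = 2 * int k \<longleftrightarrow> k = a" for x a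
    by auto
  have 1: "int m * (3 * int m + 1) = 2 * int k \<longleftrightarrow> k = m * m + triangle m"
  proof -
    have "2 * (m * m + triangle m) = m * (3 * m + 1)"
      using two_triangle[of m] by (simp add: algebra_simps)
    hence "int (2 * (m * m + triangle m)) = int (m * (3 * m + 1))"
      by (rule arg_cong)
    hence "2 * int (m * m + triangle m) = int m * (3 * int m + 1)"
      by (simp only: of_nat_mult of_nat_add of_nat_1 of_nat_numeral)
    from this[symmetric] show ?thesis by (rule *)
  qed
  have 2: "- int m * (3 * - int m + 1) = 2 * int k \<longleftrightarrow> k = m * m + triangle n"
  proof -
    have "2 * (m * m + triangle n) + m = 3 * (m * m)"
      using two_triangle[of n] by (simp add: m_def algebra_simps)
    hence "int (2 * (m * m + triangle n) + m) = int (3 * (m * m))"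
      by (rule arg_cong)
    hence "2 * int (m * m + triangle n) + int m = 3 * (int m * int m)"
      by (simp only: of_nat_mult of_nat_add of_nat_numeral)
    hence "2 * int (m * m + triangle n) = - int m * (3 * - int m + 1)"
      by (simp add: algebra_simps)
    from this[symmetric] show ?thesis by (rule *)
  qed
  define R where "R s \<longleftrightarrow> s * (3 * s + 1) = 2 * int k" for s
  have "{s. \<bar>s\<bar> \<le> int m \<and> R s} = {s \<in> {int m, - int m}. R s} \<union> {s. \<bar>s\<bar> \<le> int n \<and> R s}"
    unfolding m_def by auto
  moreover have "{s \<in> {int m, - int m}. R s} \<inter> {s. \<bar>s\<bar> \<le> int n \<and> R s} = {}"
    unfolding m_def by auto
  moreover have "finite {s. \<bar>s\<bar> \<le> int n \<and> R s}"
    by (rule finite_subset[of _ "{- int n..int n}"]) auto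
  ultimately have "(\<Sum>s | \<bar>s\<bar> \<le> int m \<and> R s. (-1) ^ nat \<bar>s\<bar>)
     = (\<Sum>s\<in>{s \<in> {int m, - int m}. R s}. (-1) ^ nat \<bar>s\<bar>)
       + (\<Sum>s | \<bar>s\<bar> \<le> int n \<and> R s. (-1) ^ nat \<bar>s\<bar> :: int)"
    by (simp add: sum.union_disjoint)
  also have "(\<Sum>s\<in>{s \<in> {int m, - int m}. R s}. (-1) ^ nat \<bar>s\<bar> :: int)
    = (\<Sum>s\<in>{int m, - int m}. if R s then (-1) ^ nat \<bar>s\<bar> else 0)"
    by (rule sum.inter_filter) simp
  also have "\<dots> = (if R (int m) then (-1) ^ m else 0) + (if R (- int m) then (-1) ^ m else 0)"
  proof -
    have "int m \<noteq> - int m"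
      by (simp add: m_def)
    thus ?thesis by simp
  qed
  also have "\<dots> = fps_nth ((-1) ^ m * (fps_X ^ (m * m + triangle m) + fps_X ^ (m * m + triangle n))) k"
    unfolding R_def 1 2 by (cases "even m") auto
  finally show ?case
    unfolding shanks_sum_Suc fps_add_nth Suc.IH m_def R_def by (simp only: add.commute)
qed

theorem euler_fps_nth:
  "fps_nth euler_fps k = (\<Sum>s | s * (3 * s + 1) = 2 * int k. (-1) ^ nat \<bar>s\<bar>)"
proof -
  have "fps_X ^ Suc k dvd (\<Sum>s\<in>{1..k}. shanks_term k s)"
  proof (rule dvd_sum)
    fix s assume s: "s \<in> {1..k}"
    have "Suc k \<le> k * s + triangle s"
      using s by (cases s) (auto simp: trans_le_add1)
    thus "fps_X ^ Suc k dvd shanks_term k s"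
      unfolding shanks_term_def by (intro dvd_mult le_imp_power_dvd)
  qed
  hence "fps_nth (\<Sum>s\<in>{1..k}. shanks_term k s) k = 0"
    unfolding fps_X_power_dvd_iff by blast
  moreover have "(\<Sum>s\<le>k. shanks_term k s) = qprod 0 k + (\<Sum>s\<in>{1..k}. shanks_term k s)"
    by (simp add: atMost_atLeast0 sum.atLeast_Suc_atMost shanks_term_def)
  ultimately have "fps_nth euler_fps k = fps_nth (\<Sum>s\<le>k. shanks_term k s) k"
    by (simp add: euler_fps_def)
  also have "\<dots> = (\<Sum>s | \<bar>s\<bar> \<le> int k \<and> s * (3 * s + 1) = 2 * int k. (-1) ^ nat \<bar>s\<bar>)"
    by (rule shanks_sum_nth)
  \<comment> \<open>The bound is automatic: |s| <= s^2 gives 2k = 3s^2 + s >= 2|s|.\<close>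
  also have "{s. \<bar>s\<bar> \<le> int k \<and> s * (3 * s + 1) = 2 * int k} = {s. s * (3 * s + 1) = 2 * int k}"
  proof -
    have "\<bar>s\<bar> \<le> int k" if "s * (3 * s + 1) = 2 * int k" for s
    proof -
      have "0 \<le> (\<bar>s\<bar> - 1) * \<bar>s\<bar>" by (cases "s = 0") auto
      moreover have "\<bar>s\<bar> * \<bar>s\<bar> = s * s" by simp
      ultimately have "\<bar>s\<bar> \<le> s * s" by (simp add: algebra_simps)
      moreover have "3 * (s * s) + s = 2 * int k" using that by (simp add: algebra_simps)
      ultimately show ?thesis by linarith
    qed
    thus ?thesis by auto
  qed
  finally show ?thesis .
qed

definition partition_fps :: "int fps" where
  "partition_fps = fps_right_inverse euler_fps 1"

lemma euler_partition [simp]: "euler_fps * partition_fps = 1"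
  unfolding partition_fps_def by (rule fps_right_inverse) simp

lemma partition_euler [simp]: "partition_fps * euler_fps = 1"
  by (simp add: mult.commute)

subsection \<open>The finite Jacobi identity\<close>

text \<open>Gaussian binomial coefficients through a q-Pascal rule, which avoids division. The
  subtraction \<open>m - k\<close> truncates only where \<open>qbinomial m k\<close> is
  zero.\<close>

fun qbinomial :: "nat \<Rightarrow> nat \<Rightarrow> int fps" where
  "qbinomial m 0 = 1"
| "qbinomial 0 (Suc k) = 0"
| "qbinomial (Suc m) (Suc k) = fps_X ^ (m - k) * qbinomial m k + qbinomial m (Suc k)"

lemma qbinomial_eq_0: "m < k \<Longrightarrow> qbinomial m k = 0"
  by (induction m k rule: qbinomial.induct) auto

lemma qbinomial_qprod:
  "k \<le> m \<Longrightarrow> qbinomial m k * qprod 0 k * qprod 0 (m - k) = qprod 0 m"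
proof (induction m k rule: qbinomial.induct)
  case (3 m k)
  hence 1: "qbinomial m k * qprod 0 k * qprod 0 (m - k) = qprod 0 m"
    by simp
  have 2: "qbinomial m (Suc k) * qprod 0 (Suc k) * qprod 0 (m - k) = qprod 0 m * (1 - fps_X ^ (m - k))"
  proof (cases "Suc k \<le> m")
    case True
    hence *: "m - k = Suc (m - Suc k)" by simp
    have "qprod 0 (m - k) = qprod 0 (m - Suc k) * (1 - fps_X ^ (m - k))"
      unfolding * by (rule qprod_Suc_right) simp
    thus ?thesis
      using "3.IH"(2)[OF True] by (simp flip: mult.assoc)
  qed (use 3 in \<open>simp add: qbinomial_eq_0\<close>)
  have "qbinomial (Suc m) (Suc k) * qprod 0 (Suc k) * qprod 0 (Suc m - Suc k)
      = fps_X ^ (m - k) * (1 - fps_X ^ Suc k) * (qbinomial m k * qprod 0 k * qprod 0 (m - k))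
        + qbinomial m (Suc k) * qprod 0 (Suc k) * qprod 0 (m - k)"
    by (simp add: qprod_Suc_right algebra_simps)
  also have "\<dots> = qprod 0 m * (1 - fps_X ^ (m - k) * fps_X ^ Suc k)"
    unfolding 1 2 by (simp add: algebra_simps)
  also have "fps_X ^ (m - k) * fps_X ^ Suc k = (fps_X ^ Suc m :: int fps)"
    using 3 by (simp flip: power_add power_Suc)
  also have "qprod 0 m * (1 - fps_X ^ Suc m) = qprod 0 (Suc m)"
    by (simp add: qprod_Suc_right)
  finally show ?case .
qed simp_all

text \<open>The q-binomial theorem in homogeneous form. Keeping \<open>a\<close> free allows
  \<open>a = fps_X ^ n\<close> later, which places a zero at 1 in the middle factor without negative
  powers of q.\<close>

lemma coeff_qbinomial:
  "coeff (\<Prod>i<m. [:a, - (fps_X ^ i):]) k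
     = (-1) ^ k * qbinomial m k * fps_X ^ triangle (k - 1) * a ^ (m - k)"
proof (induction m arbitrary: k)
  case 0
  show ?case by (cases k) auto
next
  case (Suc m)
  show ?case
  proof (cases k)
    case 0
    thus ?thesis using Suc[of 0] by (simp add: mult.commute)
  next
    case k: (Suc j)
    have 1: "qbinomial m (Suc j) * a ^ (m - Suc j) * a = qbinomial m (Suc j) * a ^ (m - j)"
    proof (cases "j < m")
      case True
      hence "m - j = Suc (m - Suc j)" by simp
      thus ?thesis by simp
    qed (simp add: qbinomial_eq_0)
    have 2: "qbinomial m j * fps_X ^ (m + triangle (j - 1)) = qbinomial m j * fps_X ^ (m - j + triangle j)"
    proof (cases "j \<le> m")
      case True
      hence "m + triangle (j - 1) = m - j + triangle j" by (cases j) auto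
      thus ?thesis by simp
    qed (simp add: qbinomial_eq_0)
    have "coeff (\<Prod>i<Suc m. [:a, - (fps_X ^ i):]) k
       = a * coeff (\<Prod>i<m. [:a, - (fps_X ^ i):]) (Suc j) - fps_X ^ m * coeff (\<Prod>i<m. [:a, - (fps_X ^ i):]) j"
      by (simp add: k mult.commute[of "prod _ _"])
    also have "\<dots> = (-1) ^ Suc j * fps_X ^ triangle j * (qbinomial m (Suc j) * a ^ (m - Suc j) * a)
        - (-1) ^ j * (qbinomial m j * fps_X ^ (m + triangle (j - 1))) * a ^ (m - j)"
      unfolding Suc by (simp add: algebra_simps power_add)
    also have "\<dots> = (-1) ^ k * qbinomial (Suc m) k * fps_X ^ triangle (k - 1) * a ^ (Suc m - k)"
      unfolding 1 2 by (simp add: k algebra_simps power_add)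
    finally show ?thesis .
  qed
qed

lemma poly_pderiv_1:
  assumes "degree p \<le> d"
  shows "poly (pderiv p) 1 = (\<Sum>k\<le>d. of_nat k * coeff p k)"
proof -
  have "pderiv p = pderiv (\<Sum>k\<le>d. monom (coeff p k) k)"
    using poly_as_sum_of_monoms'[OF assms] by simp
  also have "\<dots> = (\<Sum>k\<le>d. pderiv (monom (coeff p k) k))"
    using higher_pderiv_sum[of 1 "\<lambda>k. monom (coeff p k) k" "{..d}"] by simp
  finally show ?thesis
    by (simp add: pderiv_monom poly_sum poly_monom)
qed

lemma sum_atMost_split_mirror:
  fixes f :: "nat \<Rightarrow> 'a :: comm_monoid_add"
  shows "(\<Sum>k\<le>Suc (2 * n). f k) = (\<Sum>j\<le>n. f (n - j) + f (Suc (n + j)))"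
proof -
  have "(\<Sum>k\<le>Suc (n + m). f k) = (\<Sum>k\<le>n. f k) + (\<Sum>j\<le>m. f (Suc (n + j)))" for m
    by (induction m) (simp_all add: add.assoc)
  from this[of n] show ?thesis
    using sum.nat_diff_reindex[of f "Suc n"]
    by (simp add: sum.distrib lessThan_Suc_atMost mult_2)
qed

lemma prod_X_diff_below:
  "(\<Prod>i<n. fps_X ^ n - fps_X ^ i) = (-1) ^ n * fps_X ^ triangle (n - 1) * qprod 0 n"
proof -
  have tri: "(\<Sum>i<n. i) = triangle (n - 1)"
  proof (induction n)
    case (Suc n)
    thus ?case by (cases n) simp_all
  qed simp
  have "(\<Prod>i<n. fps_X ^ n - fps_X ^ i :: int fps) = (\<Prod>i<n. - (fps_X ^ i * (1 - fps_X ^ Suc (n - Suc i))))"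
    by (intro prod.cong) (auto simp: algebra_simps Suc_diff_Suc simp flip: power_add)
  also have "\<dots> = (-1) ^ n * fps_X ^ (\<Sum>i<n. i) * (\<Prod>i<n. 1 - fps_X ^ Suc (n - Suc i))"
    by (simp add: prod.distrib prod_uminus power_sum)
  also have "(\<Prod>i<n. 1 - fps_X ^ Suc (n - Suc i) :: int fps) = (\<Prod>i<n. 1 - fps_X ^ Suc i)"
    by (rule prod.nat_diff_reindex)
  also have "\<dots> = qprod 0 n"
    by (induction n) (simp_all add: qprod_Suc_right)
  finally show ?thesis
    unfolding tri .
qed

lemma prod_X_diff_above:
  "(\<Prod>i\<in>{n<..2 * n}. fps_X ^ n - fps_X ^ i) = fps_X ^ (n * n) * qprod 0 n"
proof -
  have "(\<Prod>i\<in>{n<..2 * n}. fps_X ^ n - fps_X ^ i :: int fps) = (\<Prod>i\<in>{0<..n}. fps_X ^ n * (1 - fps_X ^ i))"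
    by (rule prod.reindex_bij_witness[of _ "\<lambda>i. i + n" "\<lambda>i. i - n"])
       (auto simp: algebra_simps simp flip: power_add)
  thus ?thesis
    by (simp add: prod.distrib qprod_def power_mult)
qed

text \<open>The derivative at \<open>1\<close> of the product in \<open>coeff_qbinomial\<close>, with \<open>a = q\<^sup>n\<close> and \<open>2 n + 1\<close> factors: only the
  factor \<open>i = n\<close> vanishes at \<open>1\<close>, and the terms of degrees \<open>n - j\<close> and \<open>n + j + 1\<close> carry the same
  power of \<open>q\<close>.\<close>

lemma finite_jacobi:
  "(qprod 0 n)\<^sup>2 = (\<Sum>j\<le>n. (-1) ^ j * fps_X ^ triangle j *
     (of_nat (Suc (n + j)) * qbinomial (Suc (2 * n)) (Suc (n + j))
       - of_nat (n - j) * qbinomial (Suc (2 * n)) (n - j)))"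
proof -
  define m where "m = Suc (2 * n)"
  \<comment> \<open>The power of q common to both evaluations of the derivative; it cancels at the
    end.\<close>
  define e where "e = triangle n + n * n"
  define a :: "int fps" where "a = fps_X ^ n"
  define p where "p = (\<Prod>i<m. [:a, - (fps_X ^ i):])"
  define r where "r = (\<Prod>i\<in>{..<m} - {n}. [:a, - (fps_X ^ i):])"
  define S where "S = (\<Sum>j\<le>n. (-1) ^ j * fps_X ^ triangle j *
     (of_nat (Suc (n + j)) * qbinomial m (Suc (n + j)) - of_nat (n - j) * qbinomial m (n - j)))"

  have "p = [:a, - a:] * r"
    unfolding p_def r_def by (subst prod.remove[of _ n]) (auto simp: m_def a_def)
  hence "pderiv p = [:a, - a:] * pderiv r + r * [:- a:]"
    by (simp only: pderiv_mult) (simp add: pderiv_pCons)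
  hence "poly (pderiv p) 1 = - a * poly r 1"
    by simp
  also have "poly r 1 = (\<Prod>i\<in>{..<m} - {n}. fps_X ^ n - fps_X ^ i)"
    by (simp add: r_def poly_prod a_def)
  also have "{..<m} - {n} = {..<n} \<union> {n<..2 * n}"
    by (auto simp: m_def)
  also have "(\<Prod>i\<in>\<dots>. fps_X ^ n - fps_X ^ i :: int fps)
      = (\<Prod>i<n. fps_X ^ n - fps_X ^ i) * (\<Prod>i\<in>{n<..2 * n}. fps_X ^ n - fps_X ^ i)"
    by (rule prod.union_disjoint) auto
  also have "- a * \<dots> = (-1) ^ Suc n * fps_X ^ (n + triangle (n - 1) + n * n) * (qprod 0 n)\<^sup>2"
    unfolding prod_X_diff_below prod_X_diff_above a_def
    by (simp add: power_add power2_eq_square algebra_simps)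
  also have "n + triangle (n - 1) + n * n = e"
    unfolding e_def by (cases n) auto
  finally have 1: "poly (pderiv p) 1 = (-1) ^ Suc n * fps_X ^ e * (qprod 0 n)\<^sup>2" .

  \<comment> \<open>Second evaluation of the same derivative, from the coefficients of
    \<open>p\<close>.\<close>
  have "degree p \<le> m"
    by (rule degree_le) (simp add: p_def coeff_qbinomial qbinomial_eq_0)
  hence "poly (pderiv p) 1 = (\<Sum>k\<le>m. of_nat k * coeff p k)"
    by (rule poly_pderiv_1)
  also have "\<dots> = (\<Sum>j\<le>n. of_nat (n - j) * coeff p (n - j) + of_nat (Suc (n + j)) * coeff p (Suc (n + j)))"
    unfolding m_def by (rule sum_atMost_split_mirror)
  also have "\<dots> = (\<Sum>j\<le>n. (-1) ^ Suc n * fps_X ^ e * ((-1) ^ j * fps_X ^ triangle j *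
     (of_nat (Suc (n + j)) * qbinomial m (Suc (n + j)) - of_nat (n - j) * qbinomial m (n - j))))"
  proof (intro sum.cong refl)
    fix j assume "j \<in> {..n}"
    then obtain d where d: "n = j + d"
      using le_Suc_ex by auto
    have e1: "triangle (n - j - 1) + n * (m - (n - j)) = e + triangle j"
    proof -
      have "2 * triangle (d - 1) + d = d * d"
        using two_triangle[of "d - 1"] by (cases d) auto
      thus ?thesis
        using two_triangle[of n] two_triangle[of j] by (simp add: d m_def e_def algebra_simps)
    qed
    have e2: "triangle (n + j) + n * (m - Suc (n + j)) = e + triangle j"
      using two_triangle[of "n + j"] two_triangle[of n] two_triangle[of j]
      by (simp add: d m_def e_def algebra_simps)
    have s: "(-1) ^ (n - j) = ((-1) ^ n * (-1) ^ j :: int fps)"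
      using d by (simp add: power_add flip: power_mult_distrib)
    have c1: "coeff p (n - j) = (-1) ^ n * (-1) ^ j * qbinomial m (n - j) * fps_X ^ (e + triangle j)"
      unfolding p_def coeff_qbinomial a_def s
      by (simp only: mult.assoc flip: e1 power_add power_mult)
    have c2: "coeff p (Suc (n + j)) = (-1) ^ Suc (n + j) * qbinomial m (Suc (n + j)) * fps_X ^ (e + triangle j)"
      unfolding p_def coeff_qbinomial a_def 
      by (simp only: mult.assoc diff_Suc_1 flip: e2 power_add power_mult)
    show "of_nat (n - j) * coeff p (n - j) + of_nat (Suc (n + j)) * coeff p (Suc (n + j))
      = (-1) ^ Suc n * fps_X ^ e * ((-1) ^ j * fps_X ^ triangle j *
     (of_nat (Suc (n + j)) * qbinomial m (Suc (n + j)) - of_nat (n - j) * qbinomial m (n - j)))"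
      unfolding c1 c2 power_add power_Suc by (simp only: ring_distribs) (simp add: algebra_simps)
  qed
  also have "\<dots> = (-1) ^ Suc n * fps_X ^ e * S"
    by (simp only: S_def sum_distrib_left)
  finally have "(-1) ^ Suc n * fps_X ^ e * (qprod 0 n)\<^sup>2 = (-1) ^ Suc n * fps_X ^ e * S"
    unfolding 1 .
  hence "(qprod 0 n)\<^sup>2 = S"
    by simp
  thus ?thesis
    unfolding S_def m_def .
qed

text \<open>The q-binomial is (q)_m / ((q)_k (q)_l), and each of the three products agrees with the
  Euler product up to order \<open>r\<close>, so the quotient agrees with its reciprocal.\<close>

lemma euler_qbinomial:
  assumes "k + l = m" "r \<le> k" "r \<le> l"
  shows "eqmod (fps_X ^ Suc r) (euler_fps * qbinomial m k) 1"
proof -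
  have q: "eqmod (fps_X ^ Suc r) (qprod 0 i) euler_fps" if "r \<le> i" for i
    using qprod_eq_euler_mod[of i] that unfolding eqmod_def
    by (meson Suc_le_mono dvd_trans le_imp_power_dvd)
  have "eqmod (fps_X ^ Suc r) (qbinomial m k * euler_fps * euler_fps) (qbinomial m k * qprod 0 k * qprod 0 l)"
    using assms by (intro eqmod_mult eqmod_refl eqmod_sym[OF q])
  also have "qbinomial m k * qprod 0 k * qprod 0 l = qprod 0 m"
    using qbinomial_qprod[of k m] assms(1) by auto
  also have "eqmod (fps_X ^ Suc r) (qprod 0 m) euler_fps"
    using assms by (intro q) simp
  finally have "eqmod (fps_X ^ Suc r) (qbinomial m k * euler_fps * euler_fps * partition_fps)
     (euler_fps * partition_fps)"
    by (rule eqmod_mult) simp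
  thus ?thesis
    by (simp add: mult.assoc) (simp add: mult.commute)
qed

text \<open>Multiplying \<open>finite_jacobi\<close> by the Euler product turns each q-binomial into
  1 up to high order, leaving the weight (n + j + 1) - (n - j) = 2j + 1.\<close>

theorem euler_cubed_nth:
  "fps_nth (euler_fps ^ 3) n = (\<Sum>j\<le>n. if triangle j = n then (-1) ^ j * (2 * int j + 1) else 0)"
proof -
  let ?X = "fps_X ^ Suc n :: int fps"
  have *: "eqmod ?X (euler_fps * (qprod 0 n)\<^sup>2) (\<Sum>j\<le>n. (-1) ^ j * fps_X ^ triangle j * of_nat (2 * j + 1))"
    unfolding finite_jacobi sum_distrib_left
  proof (rule eqmod_sum)
    fix j assume "j \<in> {..n}"
    hence j: "j \<le> n" by simp
    let ?m = "Suc (2 * n)" and ?Y = "fps_X ^ Suc (n - j) :: int fps"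
    define U where "U = euler_fps * qbinomial ?m (Suc (n + j))"
    define V where "V = euler_fps * qbinomial ?m (n - j)"
    have "eqmod ?Y (of_nat (Suc (n + j)) * U - of_nat (n - j) * V)
        (of_nat (Suc (n + j)) * 1 - of_nat (n - j) * 1)"
      using j unfolding U_def V_def
      by (intro eqmod_diff eqmod_mult eqmod_refl euler_qbinomial[where l = "n - j"]
            euler_qbinomial[where l = "Suc (n + j)"]) auto
    also have "of_nat (Suc (n + j)) * 1 - of_nat (n - j) * 1 = (of_nat (2 * j + 1) :: int fps)"
      using j by (simp add: of_nat_diff)
    finally have "eqmod (fps_X ^ triangle j * ?Y)
       (fps_X ^ triangle j * (of_nat (Suc (n + j)) * U - of_nat (n - j) * V))
       (fps_X ^ triangle j * of_nat (2 * j + 1))"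
      by (rule eqmod_scale)
    \<comment> \<open>The q-binomials are controlled only to order n - j; the factor
      q^(\<open>triangle j\<close>) supplies the missing order, as
      \<open>j \<le> triangle j\<close>.\<close>
    moreover have "?X dvd fps_X ^ triangle j * ?Y"
    proof -
      have "j \<le> triangle j"
        by (cases j) auto
      thus ?thesis
        using j unfolding power_add[symmetric] by (intro le_imp_power_dvd) simp
    qed
    ultimately have "eqmod ?X (fps_X ^ triangle j * (of_nat (Suc (n + j)) * U - of_nat (n - j) * V))
       (fps_X ^ triangle j * of_nat (2 * j + 1))"
      by (rule eqmod_weaken)
    hence "eqmod ?X ((-1) ^ j * (fps_X ^ triangle j * (of_nat (Suc (n + j)) * U - of_nat (n - j) * V)))
       ((-1) ^ j * (fps_X ^ triangle j * of_nat (2 * j + 1)))"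
      by (rule eqmod_mult[OF eqmod_refl])
    thus "eqmod ?X (euler_fps * ((-1) ^ j * fps_X ^ triangle j *
         (of_nat (Suc (n + j)) * qbinomial ?m (Suc (n + j)) - of_nat (n - j) * qbinomial ?m (n - j))))
       ((-1) ^ j * fps_X ^ triangle j * of_nat (2 * j + 1))"
      unfolding U_def V_def by (simp only: right_diff_distrib mult.assoc mult.left_commute)
  qed
  have "eqmod ?X (euler_fps * (qprod 0 n)\<^sup>2) (euler_fps ^ 3)"
    unfolding power3_eq_cube power2_eq_square mult.assoc
    by (intro eqmod_mult eqmod_refl) (simp_all add: eqmod_def qprod_eq_euler_mod del: power_Suc)
  from eqmod_trans[OF eqmod_sym[OF this] *]
  have "fps_nth (euler_fps ^ 3) n = fps_nth (\<Sum>j\<le>n. (-1) ^ j * fps_X ^ triangle j * of_nat (2 * j + 1)) n"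
    unfolding eqmod_def fps_X_power_dvd_iff by simp
  also have "\<dots> = (\<Sum>j\<le>n. if triangle j = n then (-1) ^ j * (2 * int j + 1) else 0)"
    unfolding fps_sum_nth
  proof (intro sum.cong refl)
    fix j
    have "(-1) ^ j = fps_const ((-1) ^ j :: int)"
      by (cases "even j") (simp_all flip: fps_const_neg)
    moreover have "of_nat (2 * j + 1) = fps_const (int (2 * j + 1))"
      by (rule fps_of_nat[symmetric])
    ultimately have "(-1) ^ j * fps_X ^ triangle j * of_nat (2 * j + 1)
        = fps_const ((-1) ^ j * int (2 * j + 1)) * fps_X ^ triangle j"
      by (simp only: mult_ac flip: fps_const_mult)
    thus "fps_nth ((-1) ^ j * fps_X ^ triangle j * of_nat (2 * j + 1)) n
       = (if triangle j = n then (-1) ^ j * (2 * int j + 1) else 0)"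
      by (simp only: fps_mult_left_const_nth fps_X_power_nth) auto
  qed
  finally show ?thesis .
qed

subsection \<open>Dissection modulo 5\<close>

text \<open>Reducing \<open>r\<close> as well lets residues add under multiplication without being
  normalised.\<close>

definition supported :: "nat \<Rightarrow> nat \<Rightarrow> 'a :: comm_ring_1 fps \<Rightarrow> bool" where
  "supported d r f \<longleftrightarrow> (\<forall>n. n mod d \<noteq> r mod d \<longrightarrow> fps_nth f n = 0)"

lemma supported_numeral: "supported d 0 (numeral k)"
  by (auto simp: supported_def numeral_fps_const intro!: gr0I)

lemma supported_add: "supported d r f \<Longrightarrow> supported d r g \<Longrightarrow> supported d r (f + g)"
  by (simp add: supported_def)

lemma supported_diff: "supported d r f \<Longrightarrow> supported d r g \<Longrightarrow> supported d r (f - g)"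
  by (simp add: supported_def)

lemma supported_cong: "supported d r f \<Longrightarrow> r mod d = s mod d \<Longrightarrow> supported d s f"
  by (simp add: supported_def)

lemma supported_mult:
  assumes "supported d r f" "supported d s g"
  shows "supported d (r + s) (f * g)"
  unfolding supported_def
proof safe
  fix n assume n: "n mod d \<noteq> (r + s) mod d"
  have "fps_nth f i * fps_nth g (n - i) = 0" if "i \<le> n" for i
  proof -
    have "i mod d \<noteq> r mod d \<or> (n - i) mod d \<noteq> s mod d"
      using n that by (metis le_add_diff_inverse mod_add_eq)
    thus ?thesis
      using assms by (auto simp: supported_def)
  qed
  thus "fps_nth (f * g) n = 0"
    by (simp add: fps_mult_nth)
qed

lemma supported_power: "supported d r f \<Longrightarrow> supported d (n * r) (f ^ n)"
proof (induction n)
  case 0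
  thus ?case by (auto simp: supported_def)
next
  case (Suc n)
  thus ?case
    using supported_mult[of d r f "n * r" "f ^ n"] by simp
qed

definition fps_part :: "nat \<Rightarrow> nat \<Rightarrow> 'a :: comm_ring_1 fps \<Rightarrow> 'a fps" where
  "fps_part d r f = Abs_fps (\<lambda>n. if n mod d = r mod d then fps_nth f n else 0)"

lemma fps_part_nth: "fps_nth (fps_part d r f) n = (if n mod d = r mod d then fps_nth f n else 0)"
  by (simp add: fps_part_def)

lemma supported_part: "supported d r (fps_part d r f)"
  by (simp add: supported_def fps_part_nth)

lemma fps_part_add: "fps_part d r (f + g) = fps_part d r f + fps_part d r g"
  by (simp add: fps_eq_iff fps_part_nth)

lemma fps_part_supported:
  "supported d s f \<Longrightarrow> fps_part d r f = (if r mod d = s mod d then f else 0)"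
  by (auto simp: fps_eq_iff fps_part_nth supported_def)

text \<open>Multiplication by \<open>g\<close> moves exponents only by multiples of
  \<open>d\<close>, so extracting a residue class is linear over such series.\<close>

lemma fps_part_mult:
  assumes "supported d 0 g"
  shows "fps_part d r (f * g) = fps_part d r f * g"
proof (rule fps_ext)
  fix n
  have *: "fps_nth g (n - i) = 0 \<or> (i mod d = r mod d \<longleftrightarrow> n mod d = r mod d)" if "i \<le> n" for i
  proof (cases "(n - i) mod d = 0")
    case True
    hence "n mod d = i mod d"
      using that by (metis le_add_diff_inverse mod_add_right_eq add_0_right)
    thus ?thesis by simp
  qed (use assms in \<open>auto simp: supported_def\<close>)
  have "(if n mod d = r mod d then fps_nth f i * fps_nth g (n - i) else 0)
      = fps_nth (fps_part d r f) i * fps_nth g (n - i)" if "i \<le> n" for i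
    using *[OF that] by (auto simp: fps_part_nth)
  thus "fps_nth (fps_part d r (f * g)) n = fps_nth (fps_part d r f * g) n"
    by (auto simp: fps_part_nth fps_mult_nth intro!: sum.cong sum.neutral)
qed

lemma fps_part_sum_5:
  assumes "supported 5 0 f0" "supported 5 1 f1" "supported 5 2 f2" "supported 5 3 f3" "supported 5 4 f4"
  shows "fps_part 5 2 (f0 + f1 + f2 + f3 + f4) = f2"
    and "fps_part 5 3 (f0 + f1 + f2 + f3 + f4) = f3"
    and "fps_part 5 4 (f0 + f1 + f2 + f3 + f4) = f4"
  using assms by (simp_all add: fps_part_add fps_part_supported)

section \<open>Pentagonal and triangular numbers in residue classes\<close>

lemma mod_5_of_double:
  fixes k u w :: int
  assumes "2 * k = 5 * u + w"
  shows "k mod 5 = 3 * w mod 5"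
proof -
  \<comment> \<open>3 is the inverse of 2 modulo 5.\<close>
  have "3 * w + (3 * u - k) * 5 = k"
    using assms by simp
  thus ?thesis
    using mod_mult_self1[of "3 * w" "3 * u - k" 5] by (simp only:)
qed

text \<open>Class 1 modulo 5 comes only from s = 5t + 4, and there the quadratic fixes k modulo 25
  too. This is why b / q is a series in q^25.\<close>

lemma pentagonal_mod:
  assumes "s * (3 * s + 1) = 2 * int k"
  shows "k mod 5 \<in> {0, 1, 2}" and "k mod 5 = 1 \<Longrightarrow> k mod 25 = 1"
proof -
  define r t where "r = s mod 5" and "t = s div 5"
  have s: "s = 5 * t + r"
    by (simp add: r_def t_def)
  have r: "r \<in> {0, 1, 2, 3, 4}"
    unfolding r_def by auto
  have k: "2 * int k = 5 * (t * (15 * t + 6 * r + 1)) + r * (3 * r + 1)"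
    using assms by (simp add: s algebra_simps)
  hence mod_5: "int (k mod 5) = 3 * (r * (3 * r + 1)) mod 5"
    unfolding of_nat_mod of_nat_numeral by (rule mod_5_of_double)
  show "k mod 5 \<in> {0, 1, 2}"
    using r mod_5 by auto
  assume "k mod 5 = 1"
  hence "r = 4"
    using r mod_5 by auto
  define v where "v = t * (3 * t + 5)"
  have "2 * int k = 25 * v + 52"
    using k \<open>r = 4\<close> by (simp add: v_def algebra_simps)
  \<comment> \<open>13 is the inverse of 2 modulo 25, and 13 * 52 = 1 + 27 * 25.\<close>
  hence "1 + (13 * v - int k + 27) * 25 = int k"
    by simp
  hence "int k mod 25 = 1"
    using mod_mult_self1[of 1 "13 * v - int k + 27" 25] by (simp only:) simp
  thus "k mod 25 = 1"
    by (metis of_nat_1 of_nat_eq_iff of_nat_mod of_nat_numeral)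
qed

text \<open>Classes 2 and 4 do not occur, and class 3 forces j = 2 modulo 5, where Jacobi's weight
  2j + 1 is divisible by 5.\<close>

lemma triangle_mod_5:
  "triangle j mod 5 \<in> {0, 1, 3}" "triangle j mod 5 = 3 \<Longrightarrow> j mod 5 = 2"
proof -
  define r t where "r = int j mod 5" and "t = int j div 5"
  have j: "int j = 5 * t + r"
    by (simp add: r_def t_def)
  have r: "r \<in> {0, 1, 2, 3, 4}"
    unfolding r_def by auto
  have "2 * int (triangle j) = int j * (int j + 1)"
    using arg_cong[OF two_triangle[of j], of int] by (simp add: algebra_simps)
  hence "2 * int (triangle j) = 5 * (t * (5 * t + 2 * r + 1)) + r * (r + 1)"
    unfolding j by (simp add: algebra_simps)
  hence mod_5: "int (triangle j mod 5) = 3 * (r * (r + 1)) mod 5"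
    unfolding of_nat_mod of_nat_numeral by (rule mod_5_of_double)
  show "triangle j mod 5 \<in> {0, 1, 3}"
    using r mod_5 by auto
  assume "triangle j mod 5 = 3"
  hence "r = 2"
    using r mod_5 by auto
  thus "j mod 5 = 2"
    by (metis r_def of_nat_eq_iff of_nat_mod of_nat_numeral)
qed

lemma euler_fps_nth_eq_0:
  assumes "k mod 5 \<in> {3, 4} \<or> k mod 5 = 1 \<and> k mod 25 \<noteq> 1"
  shows "fps_nth euler_fps k = 0"
proof -
  have none: "{s. s * (3 * s + 1) = 2 * int k} = {}"
    using assms pentagonal_mod[of _ k] by fastforce
  show ?thesis
    unfolding euler_fps_nth none by simp
qed

lemma euler_cubed_nth_eq_0: 
  assumes "n mod 5 = 2"
  shows "fps_nth (euler_fps ^ 3) n = 0"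
proof -
  have "triangle j \<noteq> n" for j
    using triangle_mod_5(1)[of j] assms by auto
  thus ?thesis
    unfolding euler_cubed_nth by simp
qed

lemma euler_cubed_nth_mod_5: 
  assumes "n mod 5 \<in> {2, 3, 4}"
  shows "5 dvd fps_nth (euler_fps ^ 3) n"
  unfolding euler_cubed_nth
proof (rule dvd_sum)
  fix j
  show "5 dvd (if triangle j = n then (-1) ^ j * (2 * int j + 1) else 0)"
  proof (cases "triangle j = n")
    case True
    hence "j mod 5 = 2"
      using assms triangle_mod_5[of j] by auto
    hence "5 dvd 2 * int j + 1"
      by presburger
    thus ?thesis by simp
  qed simp
qed

section \<open>Fifth powers modulo 5\<close>

lemma eqmod_5_add_power_5: "eqmod 5 ((x + y) ^ 5) (x ^ 5 + y ^ 5 :: 'a :: comm_ring_1)"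
proof -
  have "(x + y) ^ 5 - (x ^ 5 + y ^ 5) = 5 * (x ^ 4 * y + 2 * x ^ 3 * y ^ 2 + 2 * x ^ 2 * y ^ 3 + x * y ^ 4)"
    by (simp add: power_numeral_reduce algebra_simps)
  thus ?thesis
    unfolding eqmod_def by (rule dvdI)
qed

text \<open>This is f(q)^5 = f(q^5) modulo 5. Writing f = f_0 + q g gives f^5 = f_0^5 + q^5 g^5
  modulo 5, so the induction passes to \<open>g\<close> at exponent n - 5; Fermat's theorem settles
  the constant term.\<close>

lemma power_5_nth_mod_5:
  fixes f :: "int fps"
  shows "[fps_nth (f ^ 5) n = (if 5 dvd n then fps_nth f (n div 5) else 0)] (mod 5)"
proof (induction n arbitrary: f rule: less_induct)
  case (less n)
  define g where "g = fps_shift 1 f"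
  have f: "f = fps_const (fps_nth f 0) + fps_X * g"
    by (auto simp: g_def fps_eq_iff)
  have "eqmod 5 (f ^ 5) (fps_const (fps_nth f 0) ^ 5 + (fps_X * g) ^ 5)"
    by (subst f) (rule eqmod_5_add_power_5)
  hence *: "[fps_nth (f ^ 5) n = fps_nth (fps_const (fps_nth f 0 ^ 5) + fps_X ^ 5 * g ^ 5) n] (mod 5)"
    unfolding eqmod_def dvd_numeral_fps_iff by (simp add: cong_iff_dvd_diff power_mult_distrib fps_const_power)
  show ?case
  proof (cases "n < 5")
    case True
    have "[x ^ 5 = x] (mod 5)" for x :: int
    proof -
      have "x mod 5 \<in> {0, 1, 2, 3, 4}" by auto
      hence "(x mod 5) ^ 5 mod 5 = x mod 5" by auto
      thus ?thesis by (simp add: cong_def power_mod)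
    qed
    thus ?thesis
      using * True by (cases "n = 0") (auto simp: fps_X_power_mult_nth intro: cong_trans dest: dvd_imp_le)
  next
    case False
    have "fps_nth (fps_const (fps_nth f 0 ^ 5) + fps_X ^ 5 * g ^ 5) n = fps_nth (g ^ 5) (n - 5)"
      using False by (simp add: fps_X_power_mult_nth)
    moreover have "[fps_nth (g ^ 5) (n - 5) = (if 5 dvd n - 5 then fps_nth g ((n - 5) div 5) else 0)] (mod 5)"
      using False by (intro less.IH) simp
    moreover have "5 dvd n - 5 \<longleftrightarrow> 5 dvd n" "n div 5 = Suc ((n - 5) div 5)"
      using False by (simp_all add: dvd_minus_self le_div_geq)
    ultimately show ?thesis
      using * by (auto simp: g_def intro: cong_trans)
  qed
qed

text \<open>The part of the cube of the Euler product in residue class 2 is \<open>3 a (a c + b\<^sup>2)\<close>, and it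
  vanishes by Jacobi's identity.\<close>

lemma mod_5_dissection:
  obtains a b c :: "int fps" and D where
    "euler_fps = a + b + c" "a * c = - b\<^sup>2"
    "supported 5 0 a" "supported 5 1 b" "supported 5 2 c"
    "b = fps_X * D" "supported 25 0 D"
proof
  define a b c where "a = fps_part 5 0 euler_fps" and "b = fps_part 5 1 euler_fps"
    and "c = fps_part 5 2 euler_fps"
  show sup: "supported 5 0 a" "supported 5 1 b" "supported 5 2 c"
    unfolding a_def b_def c_def by (rule supported_part)+
  show E: "euler_fps = a + b + c"
  proof (rule fps_ext)
    fix n :: nat
    have "n mod 5 < 5" by simp
    hence "n mod 5 \<in> {0, 1, 2, 3, 4}" by auto
    thus "fps_nth euler_fps n = fps_nth (a + b + c) n"
      using euler_fps_nth_eq_0[of n] by (auto simp: a_def b_def c_def fps_part_nth)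
  qed
  define D where "D = fps_shift 1 b"
  have "fps_nth b 0 = 0"
    by (simp add: b_def fps_part_nth)
  thus "b = fps_X * D"
    by (auto simp: D_def fps_eq_iff)
  show "supported 25 0 D"
    unfolding supported_def D_def
  proof safe
    fix n :: nat assume "n mod 25 \<noteq> 0 mod 25"
    hence "Suc n mod 25 \<noteq> 1"
      by presburger
    thus "fps_nth (fps_shift 1 b) n = 0"
      using euler_fps_nth_eq_0[of "Suc n"] by (auto simp: b_def fps_part_nth)
  qed
  \<comment> \<open>Monomials grouped by exponent classes 0 to 4, where \<open>a\<close>,
    \<open>b\<close>, \<open>c\<close> count 0, 1, 2.\<close>
  have cube: "euler_fps ^ 3 = (a ^ 3 + 3 * b * c\<^sup>2) + (3 * a\<^sup>2 * b + c ^ 3) + 3 * (a * (a * c + b\<^sup>2))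
      + (6 * a * b * c + b ^ 3) + (3 * b\<^sup>2 * c + 3 * a * c\<^sup>2)"
    unfolding E by (simp add: power_numeral_reduce algebra_simps)
  have 1: "supported 5 0 (a ^ 3 + 3 * b * c\<^sup>2)" "supported 5 1 (3 * a\<^sup>2 * b + c ^ 3)"
    "supported 5 3 (6 * a * b * c + b ^ 3)" "supported 5 4 (3 * b\<^sup>2 * c + 3 * a * c\<^sup>2)"
    by ((intro supported_add supported_diff)?;
      (rule supported_cong, (rule supported_mult supported_power supported_numeral sup)+, simp))+
  have "supported 5 2 (a * c + b\<^sup>2)"
    by (intro supported_add;
      (rule supported_cong, (rule supported_mult supported_power sup)+, simp))
  hence 2: "supported 5 2 (3 * (a * (a * c + b\<^sup>2)))"
    using supported_mult[OF supported_numeral supported_mult[OF sup(1)]] by fastforce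
  have "fps_part 5 2 (euler_fps ^ 3) = 3 * (a * (a * c + b\<^sup>2))"
    unfolding cube using 1(1,2) 2 1(3,4) by (rule fps_part_sum_5)
  moreover have "fps_part 5 2 (euler_fps ^ 3) = 0"
    using euler_cubed_nth_eq_0 by (auto simp: fps_eq_iff fps_part_nth)
  moreover have "fps_nth a 0 = 1"
    by (simp add: a_def fps_part_nth)
  hence "a \<noteq> 0"
    by force
  ultimately show "a * c = - b\<^sup>2"
    by (simp add: eq_neg_iff_add_eq_0)
qed

lemma partition_dissection:
  obtains N M D :: "int fps" where
    "N * M = 1" "eqmod 5 M (partition_fps ^ 5)" "supported 25 0 D"
    "fps_part 5 4 partition_fps = 5 * (fps_X ^ 4 * D ^ 4 * M)"
    "fps_part 5 3 (partition_fps\<^sup>2) = 125 * (fps_X ^ 8 * D ^ 8 * M\<^sup>2) - 10 * (fps_X ^ 3 * D ^ 3 * M)"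
proof -
  obtain a b c D :: "int fps" where E: "euler_fps = a + b + c" and ac: "a * c = - b\<^sup>2"
    and sup: "supported 5 0 a" "supported 5 1 b" "supported 5 2 c"
    and b: "b = fps_X * D" and D: "supported 25 0 D"
    by (rule mod_5_dissection)
  text \<open>With \<open>\<zeta>\<close> a primitive fifth root of unity, \<open>N\<close> is the product of the five conjugates
    \<open>a + \<zeta>\<^sup>i b + \<zeta>\<^sup>2\<^sup>i c\<close> of the Euler product, and the sum of the \<open>Q\<close>'s is the product of the four
    with \<open>i \<noteq> 0\<close>, both simplified by \<open>a c = - b\<^sup>2\<close> and split by residues modulo 5.\<close>
  define N where "N = a ^ 5 + 11 * b ^ 5 + c ^ 5"
  define Q0 where "Q0 = a ^ 4 - 3 * b ^ 3 * c"
  define Q1 where "Q1 = 2 * b\<^sup>2 * c\<^sup>2 - a ^ 3 * b"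
  define Q2 where "Q2 = 2 * a\<^sup>2 * b\<^sup>2 - b * c ^ 3"
  define Q3 where "Q3 = c ^ 4 - 3 * a * b ^ 3"
  define Q4 where "Q4 = 5 * b ^ 4"
  note Q_defs = Q0_def Q1_def Q2_def Q3_def Q4_def
  have N: "supported 5 0 N"
    unfolding N_def
    by ((intro supported_add supported_diff)?;
      (rule supported_cong, (rule supported_mult supported_power supported_numeral sup)+, simp))
  have Q: "supported 5 0 Q0" "supported 5 1 Q1" "supported 5 2 Q2" "supported 5 3 Q3" "supported 5 4 Q4"
    unfolding Q_defs
    by ((intro supported_add supported_diff)?;
      (rule supported_cong, (rule supported_mult supported_power supported_numeral sup)+, simp))+
  have "euler_fps * (Q0 + Q1 + Q2 + Q3 + Q4) = N"
    unfolding E N_def Q_defs using ac by algebra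
  hence PN: "partition_fps * N = Q0 + Q1 + Q2 + Q3 + Q4"
    by (metis mult.assoc mult_1 partition_euler)
  \<comment> \<open>\<open>N\<close> is a series in q^5, so taking the class commutes with clearing
    the denominator.\<close>
  have "fps_part 5 4 partition_fps * N = fps_part 5 4 (Q0 + Q1 + Q2 + Q3 + Q4)"
    using N by (simp add: fps_part_mult flip: PN)
  also have "\<dots> = 5 * b ^ 4"
    using fps_part_sum_5(3)[OF Q] by (simp add: Q4_def)
  finally have part4: "fps_part 5 4 partition_fps * N = 5 * b ^ 4" .

  have "partition_fps\<^sup>2 * N\<^sup>2 = (Q0 + Q1 + Q2 + Q3 + Q4)\<^sup>2"
    by (simp flip: PN power_mult_distrib)
  \<comment> \<open>Products of the \<open>Q\<close>'s grouped by the sum of their indices modulo 5,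
    in classes 0 to 4.\<close>
  also have "\<dots> = (Q0\<^sup>2 + 2 * Q1 * Q4 + 2 * Q2 * Q3) + (2 * Q0 * Q1 + 2 * Q2 * Q4 + Q3\<^sup>2)
     + (Q1\<^sup>2 + 2 * Q0 * Q2 + 2 * Q3 * Q4) + (2 * Q0 * Q3 + 2 * Q1 * Q2 + Q4\<^sup>2)
     + (Q2\<^sup>2 + 2 * Q0 * Q4 + 2 * Q1 * Q3)"
    by (simp add: power2_eq_square algebra_simps)
  finally have P2N: "partition_fps\<^sup>2 * N\<^sup>2 = \<dots>" .
  have sQ: "supported 5 0 (Q0\<^sup>2 + 2 * Q1 * Q4 + 2 * Q2 * Q3)"
     "supported 5 1 (2 * Q0 * Q1 + 2 * Q2 * Q4 + Q3\<^sup>2)"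
     "supported 5 2 (Q1\<^sup>2 + 2 * Q0 * Q2 + 2 * Q3 * Q4)"
     "supported 5 3 (2 * Q0 * Q3 + 2 * Q1 * Q2 + Q4\<^sup>2)"
     "supported 5 4 (Q2\<^sup>2 + 2 * Q0 * Q4 + 2 * Q1 * Q3)"
    by ((intro supported_add supported_diff)?;
      (rule supported_cong, (rule supported_mult supported_power supported_numeral Q)+, simp))+
  have "fps_part 5 3 (partition_fps\<^sup>2) * N\<^sup>2 = fps_part 5 3 (partition_fps\<^sup>2 * N\<^sup>2)"
    using supported_power[OF N, of 2] by (intro fps_part_mult[symmetric]) simp
  also have "\<dots> = 2 * Q0 * Q3 + 2 * Q1 * Q2 + Q4\<^sup>2"
    unfolding P2N using sQ by (rule fps_part_sum_5)
  also have "\<dots> = 125 * b ^ 8 - 10 * b ^ 3 * N"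
    unfolding N_def Q_defs using ac by algebra
  finally have part3: "fps_part 5 3 (partition_fps\<^sup>2) * N\<^sup>2 = 125 * b ^ 8 - 10 * b ^ 3 * N" .

  \<comment> \<open>Only \<open>a\<close> has a constant term, namely 1, so \<open>N\<close> is
    invertible over the integers.\<close>
  have 0: "fps_nth b 0 = 0" "fps_nth c 0 = 0"
    using sup by (auto simp: supported_def)
  moreover have "fps_nth (a + b + c) 0 = 1"
    unfolding E[symmetric] by simp
  ultimately have "fps_nth N 0 = 1"
    by (simp add: N_def fps_power_zeroth)
  hence NM: "N * fps_right_inverse N 1 = 1"
    by (intro fps_right_inverse) simp
  define M where "M = fps_right_inverse N 1"
  note NM = NM[folded M_def]

  \<comment> \<open>Since 11 = 1 modulo 5, \<open>N\<close> agrees with the fifth power of the Euler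
    product modulo 5.\<close>
  have "eqmod 5 (euler_fps ^ 5) (a ^ 5 + b ^ 5 + c ^ 5)"
    unfolding E using eqmod_5_add_power_5 eqmod_add[OF eqmod_5_add_power_5 eqmod_refl] by (rule eqmod_trans)
  also have "a ^ 5 + b ^ 5 + c ^ 5 - N = 5 * (- 2 * b ^ 5)"
    by (simp add: N_def)
  hence "eqmod 5 (a ^ 5 + b ^ 5 + c ^ 5) N"
    unfolding eqmod_def by (rule dvdI)
  finally have "eqmod 5 (M * partition_fps ^ 5 * euler_fps ^ 5) (M * partition_fps ^ 5 * N)"
    by (rule eqmod_mult[OF eqmod_refl])
  moreover have "M * partition_fps ^ 5 * euler_fps ^ 5 = M"
    by (simp add: mult.assoc flip: power_mult_distrib)
  moreover have "M * partition_fps ^ 5 * N = partition_fps ^ 5"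
    using NM by (simp add: mult_ac)
  ultimately have M: "eqmod 5 M (partition_fps ^ 5)"
    by simp

  have "fps_part 5 4 partition_fps = fps_part 5 4 partition_fps * N * M"
    using NM by (simp add: mult.assoc)
  also have "\<dots> = 5 * (fps_X ^ 4 * D ^ 4 * M)"
    unfolding part4 by (simp add: b power_mult_distrib mult.assoc)
  finally have 4: "fps_part 5 4 partition_fps = 5 * (fps_X ^ 4 * D ^ 4 * M)" .
  have "fps_part 5 3 (partition_fps\<^sup>2) = fps_part 5 3 (partition_fps\<^sup>2) * N\<^sup>2 * M\<^sup>2"
    using NM by (simp add: mult.assoc flip: power_mult_distrib)
  also have "\<dots> = 125 * b ^ 8 * M\<^sup>2 - 10 * b ^ 3 * M"
    unfolding part3 using NM by algebra
  also have "\<dots> = 125 * (fps_X ^ 8 * D ^ 8 * M\<^sup>2) - 10 * (fps_X ^ 3 * D ^ 3 * M)"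
    by (simp add: b power_mult_distrib mult.assoc)
  finally show ?thesis
    using that NM M D 4 by blast
qed

section \<open>Congruences for the coefficients of P and its square\<close>

lemma partition_nth_mod_5: "5 dvd fps_nth partition_fps (5 * n + 4)"
proof -
  obtain f where "fps_part 5 4 partition_fps = 5 * f"
    by (metis partition_dissection)
  moreover have "fps_nth partition_fps (5 * n + 4) = fps_nth (fps_part 5 4 partition_fps) (5 * n + 4)"
    by (simp add: fps_part_nth)
  ultimately show ?thesis
    by (simp add: numeral_fps_const)
qed

text \<open>Modulo 5 the fifth power is P(q^5). Removing a multiple of 25 from 25n + 20 leaves 5(5l
  + 4), so only coefficients p(5l + 4) enter.\<close>

lemma mult_partition_power_5_nth_mod_5:
  assumes "supported 25 0 F"
  shows "5 dvd fps_nth (F * partition_fps ^ 5) (25 * n + 20)"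
  unfolding fps_mult_nth
proof (rule dvd_sum)
  fix i assume i: "i \<in> {0..25 * n + 20}"
  show "5 dvd fps_nth F i * fps_nth (partition_fps ^ 5) (25 * n + 20 - i)"
  proof (cases "i mod 25 = 0")
    case True
    then obtain m where m: "i = 25 * m" by auto
    hence "25 * n + 20 - i = 5 * (5 * (n - m) + 4)"
      using i by auto
    hence "[fps_nth (partition_fps ^ 5) (25 * n + 20 - i) = fps_nth partition_fps (5 * (n - m) + 4)] (mod 5)"
      using power_5_nth_mod_5[of partition_fps "25 * n + 20 - i"] by simp
    hence "5 dvd fps_nth (partition_fps ^ 5) (25 * n + 20 - i)"
      using partition_nth_mod_5 cong_dvd_iff by blast
    thus ?thesis by simp
  qed (use assms in \<open>simp add: supported_def\<close>)
qed

text \<open>The powers of \<open>D\<close> stay in q^25, and q^k shifts the class 20 modulo 25;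
  \<open>k = 4\<close> and \<open>k = 3\<close> serve the classes 24 and 23.\<close>

lemma X_power_mult_nth_mod_5:
  assumes "supported 25 0 D" "eqmod 5 M (partition_fps ^ 5)" "m = 25 * n + 20 + k"
  shows "5 dvd fps_nth (fps_X ^ k * D ^ k * M) m"
proof -
  have "supported 25 0 (D ^ k)"
    using supported_power[OF assms(1), of k] by simp
  hence "5 dvd fps_nth (D ^ k * partition_fps ^ 5) (25 * n + 20)"
    by (rule mult_partition_power_5_nth_mod_5)
  moreover have "eqmod 5 (D ^ k * M) (D ^ k * partition_fps ^ 5)"
    using assms(2) by (intro eqmod_mult eqmod_refl)
  hence "5 dvd fps_nth (D ^ k * M) (25 * n + 20) - fps_nth (D ^ k * partition_fps ^ 5) (25 * n + 20)"
    unfolding eqmod_def dvd_numeral_fps_iff fps_sub_nth by blast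
  ultimately have "5 dvd fps_nth (D ^ k * M) (25 * n + 20)"
    by (metis diff_add_cancel dvd_add)
  thus ?thesis
    unfolding assms(3) by (simp add: mult.assoc fps_X_power_mult_nth)
qed

lemma partition_nth_mod_25: "25 dvd fps_nth partition_fps (25 * n + 24)"
proof -
  obtain N M D :: "int fps" where M: "eqmod 5 M (partition_fps ^ 5)" "supported 25 0 D"
    and part: "fps_part 5 4 partition_fps = 5 * (fps_X ^ 4 * D ^ 4 * M)"
    by (rule partition_dissection)
  have "(25 * n + 24) mod 5 = 4"
    by presburger
  hence "fps_nth partition_fps (25 * n + 24) = fps_nth (fps_part 5 4 partition_fps) (25 * n + 24)"
    by (simp add: fps_part_nth)
  also have "\<dots> = 5 * fps_nth (fps_X ^ 4 * D ^ 4 * M) (25 * n + 24)"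
    unfolding part by (simp add: numeral_fps_const)
  also have "5 * 5 dvd \<dots>"
    by (intro mult_dvd_mono dvd_refl X_power_mult_nth_mod_5[OF M(2,1)]) simp
  finally show ?thesis
    by simp
qed

lemma partition_sq_nth_mod_25: "25 dvd fps_nth (partition_fps\<^sup>2) (25 * n + 23)"
proof -
  obtain N M D :: "int fps" where M: "eqmod 5 M (partition_fps ^ 5)" "supported 25 0 D"
    and part: "fps_part 5 3 (partition_fps\<^sup>2)
      = 125 * (fps_X ^ 8 * D ^ 8 * M\<^sup>2) - 10 * (fps_X ^ 3 * D ^ 3 * M)"
    by (rule partition_dissection)
  have "(25 * n + 23) mod 5 = 3"
    by presburger
  hence "fps_nth (partition_fps\<^sup>2) (25 * n + 23) = fps_nth (fps_part 5 3 (partition_fps\<^sup>2)) (25 * n + 23)"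
    by (simp add: fps_part_nth)
  also have "\<dots> = 125 * fps_nth (fps_X ^ 8 * D ^ 8 * M\<^sup>2) (25 * n + 23)
      - 10 * fps_nth (fps_X ^ 3 * D ^ 3 * M) (25 * n + 23)"
    unfolding part by (simp only: fps_sub_nth numeral_fps_const fps_mult_left_const_nth)
  moreover have "10 * 5 dvd 10 * fps_nth (fps_X ^ 3 * D ^ 3 * M) (25 * n + 23)"
    by (intro mult_dvd_mono dvd_refl X_power_mult_nth_mod_5[OF M(2,1)]) simp
  hence "25 dvd 10 * fps_nth (fps_X ^ 3 * D ^ 3 * M) (25 * n + 23)"
    by (rule dvd_trans[rotated]) simp
  ultimately show ?thesis
    by simp
qed

lemma partition_sq_nth_mod_5:
  assumes "n mod 5 \<in> {2, 3, 4}"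
  shows "5 dvd fps_nth (partition_fps\<^sup>2) n"
proof -
  have "partition_fps\<^sup>2 = partition_fps\<^sup>2 * (euler_fps * partition_fps) ^ 3"
    by simp
  also have "\<dots> = euler_fps ^ 3 * partition_fps ^ 5"
    unfolding power_mult_distrib by (simp add: mult_ac flip: power_add)
  finally have "fps_nth (partition_fps\<^sup>2) n = fps_nth (euler_fps ^ 3 * partition_fps ^ 5) n"
    by simp
  also have "5 dvd \<dots>"
    unfolding fps_mult_nth
  proof (rule dvd_sum)
    fix i assume i: "i \<in> {0..n}"
    show "5 dvd fps_nth (euler_fps ^ 3) i * fps_nth (partition_fps ^ 5) (n - i)"
    \<comment> \<open>The fifth power contributes modulo 5 only at multiples of 5; then
      \<open>i\<close> lies in the class of \<open>n\<close>, where the cube is divisible by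
      5.\<close>
    proof (cases "5 dvd n - i")
      case True
      hence "i mod 5 = n mod 5"
        using i by (metis atLeastAtMost_iff mod_eq_dvd_iff_nat)
      thus ?thesis
        using assms euler_cubed_nth_mod_5[of i] by simp
    next
      case False
      thus ?thesis
        using power_5_nth_mod_5[of partition_fps "n - i"] by (simp add: cong_0_iff)
    qed
  qed
  finally show ?thesis .
qed

subsection \<open>The two products as partition series\<close>

lemma prod_geometric_qprod: "(\<Prod>j\<le>n. geometric_fps (Suc j)) * qprod 0 (Suc n) = 1"
proof -
  have "qprod 0 (Suc n) = (\<Prod>j\<le>n. 1 - fps_X ^ Suc j)"
    by (induction n) (simp_all add: qprod_Suc_right)
  thus ?thesis
    by (simp add: geometric_fps_mult flip: prod.distrib del: power_Suc)
qed

lemma prod_geometric_eqmod_partition: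
  "eqmod (fps_X ^ Suc n) (\<Prod>j\<le>n. geometric_fps (Suc j)) partition_fps"
proof -
  define G where "G = (\<Prod>j\<le>n. geometric_fps (Suc j) :: int fps)"
  have "fps_X ^ Suc n dvd (fps_X ^ Suc (Suc n) :: int fps)"
    by (intro le_imp_power_dvd) simp
  hence q: "eqmod (fps_X ^ Suc n) (qprod 0 (Suc n)) euler_fps"
    using qprod_eq_euler_mod unfolding eqmod_def by (rule dvd_trans)
  have "eqmod (fps_X ^ Suc n) (G * partition_fps * euler_fps) (G * partition_fps * qprod 0 (Suc n))"
    by (rule eqmod_mult[OF eqmod_refl eqmod_sym[OF q]])
  moreover have "G * partition_fps * euler_fps = G"
    by (simp add: mult.assoc)
  moreover have "G * partition_fps * qprod 0 (Suc n) = partition_fps"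
    using prod_geometric_qprod[of n] by (simp add: G_def mult_ac)
  ultimately show ?thesis
    by (simp only: G_def)
qed

lemma eqmod_X_power_nth: "eqmod (fps_X ^ n) f g \<Longrightarrow> i < n \<Longrightarrow> fps_nth f i = fps_nth g i"
  by (auto simp: eqmod_def fps_X_power_dvd_iff)

lemma prod_A_eq:
  "(\<Prod>j. 1 / (1 - fps_X ^ Suc j)\<^sup>2) = Abs_fps (\<lambda>n. of_int (fps_nth (partition_fps\<^sup>2) n) :: rat)"
proof -
  have "fps_nth (\<Prod>j\<le>n. (geometric_fps (Suc j))\<^sup>2) n = fps_nth (partition_fps\<^sup>2) n" for n
    by (rule eqmod_X_power_nth[of "Suc n"])
      (auto simp del: power_Suc simp: prod_power_distrib[symmetric]
        intro!: eqmod_power prod_geometric_eqmod_partition)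
  from this[symmetric] show ?thesis
    using has_prod_unique[OF has_prod_A[where 'a = rat]]
    by (simp add: of_int_fps_nth_prod[OF of_int_geometric_fps_sq])
qed

lemma fps_compose_X_power_nth:
  assumes "k > 0"
  shows "fps_nth (f oo fps_X ^ k :: 'a :: comm_ring_1 fps) n = (if k dvd n then fps_nth f (n div k) else 0)"
proof -
  have "fps_nth (f oo fps_X ^ k) n = (\<Sum>i=0..n. if n = k * i then fps_nth f i else 0)"
    unfolding fps_compose_nth by (intro sum.cong) (simp_all flip: power_mult)
  also have "\<dots> = (\<Sum>i=0..n. if i = n div k then (if k dvd n then fps_nth f (n div k) else 0) else 0)"
    using assms by (intro sum.cong) auto
  also have "\<dots> = (if k dvd n then fps_nth f (n div k) else 0)"
    by simp
  finally show ?thesis .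
qed

lemma geometric_fps_compose:
  assumes "k > 0"
  shows "geometric_fps m oo fps_X ^ k = (geometric_fps (k * m) :: 'a :: comm_ring_1 fps)"
  using assms by (auto simp: fps_eq_iff fps_compose_X_power_nth geometric_fps_def elim!: dvdE)

text \<open>The product is the partition product at q^2; its n + 1 factors exceed the precision
  needed at exponent \<open>n div 2\<close>.\<close>

lemma prod_B_eq:
  "(\<Prod>j. 1 / (1 - fps_X ^ (2 * Suc j)))
  = Abs_fps (\<lambda>n. of_int (if even n then fps_nth partition_fps (n div 2) else 0) :: rat)"
proof -
  have "fps_nth (\<Prod>j\<le>n. geometric_fps (2 * Suc j)) n
    = (if even n then fps_nth partition_fps (n div 2) else 0)" for n
  proof -
    have "(\<Prod>j\<le>n. geometric_fps (2 * Suc j)) = (\<Prod>j\<le>n. geometric_fps (Suc j) :: int fps) oo fps_X ^ 2"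
      by (subst fps_compose_prod_distrib) (simp_all add: geometric_fps_compose)
    moreover have "fps_nth (\<Prod>j\<le>n. geometric_fps (Suc j)) (n div 2) = fps_nth partition_fps (n div 2)"
      by (rule eqmod_X_power_nth[OF prod_geometric_eqmod_partition]) simp
    ultimately show ?thesis
      by (simp add: fps_compose_X_power_nth)
  qed
  from this[symmetric] show ?thesis
    using has_prod_unique[OF has_prod_B[where 'a = rat]]
    by (simp only: of_int_fps_nth_prod[OF of_int_geometric_fps])
qed

section \<open>Transfer of the congruences to the half-sum\<close>

theorem proposition30:
  fixes pA :: "nat \<Rightarrow> int"
  assumes "Abs_fps (\<lambda>n. of_int (pA n) :: rat) =
    fps_const (1 / 2) * (\<Prod>j. 1 / (1 - fps_X ^ Suc j)\<^sup>2) +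
    fps_const (1 / 2) * (\<Prod>j. 1 / (1 - fps_X ^ (2 * Suc j)))"
  shows "\<forall>n. [pA (5 * n + 3) = 0] (mod 5) \<and>
      [pA (10 * n + 7) = 0] (mod 5) \<and>
      [pA (10 * n + 9) = 0] (mod 5) \<and>
      [pA (25 * n + 23) = 0] (mod 25)"
proof -
  have pA: "2 * pA n
      = fps_nth (partition_fps\<^sup>2) n + (if even n then fps_nth partition_fps (n div 2) else 0)" for n
  proof -
    have "of_int (pA n) = (1 / 2 * of_int (fps_nth (partition_fps\<^sup>2) n)
        + 1 / 2 * of_int (if even n then fps_nth partition_fps (n div 2) else 0) :: rat)"
      using arg_cong[OF assms, of "\<lambda>f. fps_nth f n"] unfolding prod_A_eq prod_B_eq by simp
    hence "of_int (2 * pA n) = (of_int (fps_nth (partition_fps\<^sup>2) n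
        + (if even n then fps_nth partition_fps (n div 2) else 0)) :: rat)"
      by (simp add: field_simps)
    thus ?thesis
      by (simp only: of_int_eq_iff)
  qed
  \<comment> \<open>P(q^2) contributes only at even n, and there n = 3 modulo 5 makes n / 2 = 4
    modulo 5. The classes 7 and 9 modulo 10 are odd and avoid it.\<close>
  have 5: "5 dvd pA n" if "n mod 5 \<in> {2, 3, 4}" "even n \<Longrightarrow> n mod 5 = 3" for n
  proof -
    have "5 dvd fps_nth partition_fps (n div 2)" if "even n"
    proof -
      have "n = 5 * (n div 5) + 3"
        using \<open>even n \<Longrightarrow> n mod 5 = 3\<close>[OF that] by (metis mult_div_mod_eq)
      moreover have "n = 2 * (n div 2)"
        using that by simp
      ultimately have "2 * int (n div 2) = 5 * int (n div 5) + 3"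
        by linarith
      hence "int (n div 2 mod 5) = 4"
        unfolding of_nat_mod of_nat_numeral by (subst mod_5_of_double) auto
      hence "n div 2 = 5 * (n div 2 div 5) + 4"
        by (metis mult_div_mod_eq of_nat_eq_iff of_nat_numeral)
      thus ?thesis
        using partition_nth_mod_5 by metis
    qed
    hence "5 dvd 2 * pA n"
      unfolding pA using partition_sq_nth_mod_5[OF that(1)] by auto
    thus ?thesis
      by (subst (asm) coprime_dvd_mult_right_iff) simp_all
  qed
  have 25: "25 dvd pA (25 * n + 23)" for n
  proof -
    have "25 dvd fps_nth partition_fps ((25 * n + 23) div 2)" if "even (25 * n + 23)"
    proof -
      have "odd n"
        using that by simp
      then obtain k where "n = 2 * k + 1"
        by (rule oddE)
      hence "(25 * n + 23) div 2 = 25 * k + 24"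
        by simp
      thus ?thesis
        using partition_nth_mod_25 by metis
    qed
    hence "25 dvd 2 * pA (25 * n + 23)"
      unfolding pA using partition_sq_nth_mod_25[of n] by auto
    thus ?thesis
      by (subst (asm) coprime_dvd_mult_right_iff) simp_all
  qed
  have "5 dvd pA (5 * n + 3)" "5 dvd pA (10 * n + 7)" "5 dvd pA (10 * n + 9)" for n
    by (rule 5; simp; presburger)+
  thus ?thesis
    using 25 by (simp add: cong_0_iff)
qed

end
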